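(* Let $d$ be an integer, let $n\in\mathbb{N}$, and let $A$ be a $1$-principled $n\times n$-matrix over $\mathbb{Z}/d\mathbb{Z}$. Then $A^m$ is $1$-principled for every $m\in\mathbb{Z}$.
   Context: $\mathbb{N}=\{0,1,2,\ldots\}$ and $[n]:=\{1,2,\ldots,n\}$. For an $n\times n$-matrix $A$ over a commutative ring and $S\subseteq[n]$, $A_S$ denotes the principal submatrix of $A$ with row and column set $S$; the empty determinant is $1$. The matrix $A$ is $1$-principled if $\det A_S = 1$ for every $S\subseteq[n]$. (Such a matrix has determinant $1$, hence is invertible, so $A^m$ is defined for every integer $m$.) *)

theory Defs
  imports "HOL-Algebra.IntRing" "HOL-Combinatorics.Permutations"
begin

text \<open>
  Matrices over a ring in the sense of HOL-Algebra, with rows and columns indexed by a set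
  \<open>I\<close>; an \<open>n \<times> n\<close> matrix is the case \<open>I = {1..n}\<close>. HOL-Algebra rings are needed because
  \<open>ZFact d\<close>, the quotient of the integers by the ideal generated by \<open>d\<close>, has to be covered for
  every integer \<open>d\<close>, including \<open>d = 0\<close> and the zero ring \<open>d = 1\<close>. Matrices are extensional, so
  that they form a monoid and the integer powers of HOL-Algebra apply.
\<close>

definition mat_monoid :: "('a, 'b) ring_scheme \<Rightarrow> 'i set \<Rightarrow> ('i \<times> 'i \<Rightarrow> 'a) monoid" where
  "mat_monoid R I =
    \<lparr> carrier = (I \<times> I) \<rightarrow>\<^sub>E carrier R,
      mult = (\<lambda>A B. \<lambda>(i, j) \<in> I \<times> I. \<Oplus>\<^bsub>R\<^esub>k\<in>I. A (i, k) \<otimes>\<^bsub>R\<^esub> B (k, j)),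
      one = (\<lambda>(i, j) \<in> I \<times> I. if i = j then \<one>\<^bsub>R\<^esub> else \<zero>\<^bsub>R\<^esub>) \<rparr>"

definition mat_det :: "('a, 'b) ring_scheme \<Rightarrow> 'i set \<Rightarrow> ('i \<times> 'i \<Rightarrow> 'a) \<Rightarrow> 'a" where
  "mat_det R I A =
    (\<Oplus>\<^bsub>R\<^esub>p\<in>{p. p permutes I}. [sign p] \<cdot>\<^bsub>R\<^esub> (\<Otimes>\<^bsub>R\<^esub>i\<in>I. A (i, p i)))"

definition principal_submat :: "('i \<times> 'i \<Rightarrow> 'a) \<Rightarrow> 'i set \<Rightarrow> 'i \<times> 'i \<Rightarrow> 'a" where
  "principal_submat A S = restrict A (S \<times> S)"

definition one_principled :: "('a, 'b) ring_scheme \<Rightarrow> 'i set \<Rightarrow> ('i \<times> 'i \<Rightarrow> 'a) \<Rightarrow> bool" where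
  "one_principled R I A \<longleftrightarrow>
    A \<in> carrier (mat_monoid R I) \<and>
    (\<forall>S \<subseteq> I. mat_det R S (principal_submat A S) = \<one>\<^bsub>R\<^esub>)"

lemma (in cring) mat_det_empty: "mat_det R {} A = \<one>"
proof -
  have "{p :: 'c \<Rightarrow> 'c. p permutes {}} = {id}" by auto
  then show ?thesis
    by (simp add: mat_det_def add.int_pow_1)
qed

lemma (in abelian_monoid) finsum_swap:
  assumes "finite A" "finite B" and "\<And>i j. i \<in> A \<Longrightarrow> j \<in> B \<Longrightarrow> f i j \<in> carrier G"
  shows "(\<Oplus>i\<in>A. \<Oplus>j\<in>B. f i j) = (\<Oplus>j\<in>B. \<Oplus>i\<in>A. f i j)"
  using assms(1,3)
proof (induction A)
  case empty
  then show ?case by (simp add: finsum_zero)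
next
  case (insert a A)
  have "(\<Oplus>j\<in>B. \<Oplus>i\<in>insert a A. f i j) = (\<Oplus>j\<in>B. f a j \<oplus> (\<Oplus>i\<in>A. f i j))"
    using insert by (intro finsum_cong') (auto intro!: finsum_closed finsum_insert)
  also have "\<dots> = (\<Oplus>j\<in>B. f a j) \<oplus> (\<Oplus>j\<in>B. \<Oplus>i\<in>A. f i j)"
    using insert by (intro finsum_addf) (auto intro!: finsum_closed)
  finally show ?case
    using insert by (simp add: finsum_insert Pi_def finsum_closed)
qed

lemma (in ring) monoid_mat_monoid:
  assumes I: "finite I"
  shows "monoid (mat_monoid R I)"
proof -
  have entry: "A (i, j) \<in> carrier R"
    if "A \<in> (I \<times> I) \<rightarrow>\<^sub>E carrier R" "i \<in> I" "j \<in> I" for A i j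
    using that by auto
  have delta_l: "(\<Oplus>k\<in>I. (if i = k then \<one> else \<zero>) \<otimes> f k) = f i"
    if "i \<in> I" "\<And>k. k \<in> I \<Longrightarrow> f k \<in> carrier R" for i f
  proof -
    have "(\<Oplus>k\<in>I. (if i = k then \<one> else \<zero>) \<otimes> f k) = (\<Oplus>k\<in>I. if i = k then f k else \<zero>)"
      using that by (intro finsum_cong') auto
    with that I show ?thesis by (simp add: finsum_singleton)
  qed
  have delta_r: "(\<Oplus>k\<in>I. f k \<otimes> (if k = j then \<one> else \<zero>)) = f j"
    if "j \<in> I" "\<And>k. k \<in> I \<Longrightarrow> f k \<in> carrier R" for j f
  proof -
    have "(\<Oplus>k\<in>I. f k \<otimes> (if k = j then \<one> else \<zero>)) = (\<Oplus>k\<in>I. if j = k then f k else \<zero>)"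
      using that by (intro finsum_cong') auto
    with that I show ?thesis by (simp add: finsum_singleton)
  qed
  have assoc: "(\<Oplus>l\<in>I. (\<Oplus>k\<in>I. A (i, k) \<otimes> B (k, l)) \<otimes> C (l, j))
      = (\<Oplus>k\<in>I. A (i, k) \<otimes> (\<Oplus>l\<in>I. B (k, l) \<otimes> C (l, j)))"
    if A: "A \<in> (I \<times> I) \<rightarrow>\<^sub>E carrier R" and B: "B \<in> (I \<times> I) \<rightarrow>\<^sub>E carrier R"
      and C: "C \<in> (I \<times> I) \<rightarrow>\<^sub>E carrier R" and "i \<in> I" "j \<in> I" for A B C i j
  proof -
    note cl = entry[OF A] entry[OF B] entry[OF C]
    have "(\<Oplus>l\<in>I. (\<Oplus>k\<in>I. A (i, k) \<otimes> B (k, l)) \<otimes> C (l, j))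
        = (\<Oplus>l\<in>I. \<Oplus>k\<in>I. A (i, k) \<otimes> B (k, l) \<otimes> C (l, j))"
      using I cl that(4,5) by (intro finsum_cong' finsum_ldistr) (auto intro!: finsum_closed)
    also have "\<dots> = (\<Oplus>k\<in>I. \<Oplus>l\<in>I. A (i, k) \<otimes> B (k, l) \<otimes> C (l, j))"
      using I cl that(4,5) by (intro finsum_swap) auto
    also have "\<dots> = (\<Oplus>k\<in>I. \<Oplus>l\<in>I. A (i, k) \<otimes> (B (k, l) \<otimes> C (l, j)))"
      using cl that(4,5) by (intro finsum_cong' m_assoc) (auto intro!: finsum_closed)
    also have "\<dots> = (\<Oplus>k\<in>I. A (i, k) \<otimes> (\<Oplus>l\<in>I. B (k, l) \<otimes> C (l, j)))"
      using I cl that(4,5)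
      by (intro finsum_cong' finsum_rdistr[symmetric]) (auto intro!: finsum_closed)
    finally show ?thesis .
  qed
  let ?M = "mat_monoid R I"
  have mult: "(A \<otimes>\<^bsub>?M\<^esub> B) (i, j) = (\<Oplus>k\<in>I. A (i, k) \<otimes> B (k, j))"
    if "i \<in> I" "j \<in> I" for A B i j
    using that by (simp add: mat_monoid_def)
  have one: "\<one>\<^bsub>?M\<^esub> (i, j) = (if i = j then \<one> else \<zero>)" if "i \<in> I" "j \<in> I" for i j
    using that by (simp add: mat_monoid_def)
  have carr: "carrier ?M = (I \<times> I) \<rightarrow>\<^sub>E carrier R"
    by (simp add: mat_monoid_def)
  have mult_closed: "A \<otimes>\<^bsub>?M\<^esub> B \<in> carrier ?M" if "A \<in> carrier ?M" "B \<in> carrier ?M" for A B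
    using that entry unfolding mat_monoid_def by (auto intro!: finsum_closed)
  have one_closed: "\<one>\<^bsub>?M\<^esub> \<in> carrier ?M"
    by (auto simp: mat_monoid_def)
  have eqI: "A = B"
    if "A \<in> carrier ?M" "B \<in> carrier ?M"
      and "\<And>i j. i \<in> I \<Longrightarrow> j \<in> I \<Longrightarrow> A (i, j) = B (i, j)" for A B
    using that unfolding carr by (intro PiE_ext[of A "I \<times> I" "\<lambda>_. carrier R" B]) auto
  have mult_cong: "(\<Oplus>k\<in>I. f k \<otimes> g k) = (\<Oplus>k\<in>I. f' k \<otimes> g' k)"
    if "\<And>k. k \<in> I \<Longrightarrow> f k = f' k" "\<And>k. k \<in> I \<Longrightarrow> g k = g' k"
      "\<And>k. k \<in> I \<Longrightarrow> f' k \<in> carrier R" "\<And>k. k \<in> I \<Longrightarrow> g' k \<in> carrier R" for f g f' g'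
    using that by (intro finsum_cong') auto
  show ?thesis
  proof (rule monoidI)
    fix A B C
    assume A: "A \<in> carrier ?M" and B: "B \<in> carrier ?M" and C: "C \<in> carrier ?M"
    show "A \<otimes>\<^bsub>?M\<^esub> B \<otimes>\<^bsub>?M\<^esub> C = A \<otimes>\<^bsub>?M\<^esub> (B \<otimes>\<^bsub>?M\<^esub> C)"
    proof (rule eqI)
      fix i j assume ij: "i \<in> I" "j \<in> I"
      note cl = entry[OF A[unfolded carr]] entry[OF B[unfolded carr]] entry[OF C[unfolded carr]]
      have "(A \<otimes>\<^bsub>?M\<^esub> B \<otimes>\<^bsub>?M\<^esub> C) (i, j) = (\<Oplus>l\<in>I. (\<Oplus>k\<in>I. A (i, k) \<otimes> B (k, l)) \<otimes> C (l, j))"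
        using ij cl by (subst mult) (auto intro!: mult_cong finsum_closed simp: mult)
      also have "\<dots> = (\<Oplus>k\<in>I. A (i, k) \<otimes> (\<Oplus>l\<in>I. B (k, l) \<otimes> C (l, j)))"
        using assoc A B C ij unfolding carr by blast
      also have "\<dots> = (A \<otimes>\<^bsub>?M\<^esub> (B \<otimes>\<^bsub>?M\<^esub> C)) (i, j)"
        using ij cl by (subst mult) (auto intro!: mult_cong[symmetric] finsum_closed simp: mult)
      finally show "(A \<otimes>\<^bsub>?M\<^esub> B \<otimes>\<^bsub>?M\<^esub> C) (i, j) = (A \<otimes>\<^bsub>?M\<^esub> (B \<otimes>\<^bsub>?M\<^esub> C)) (i, j)" .
    qed (use A B C mult_closed in auto)
  next
    fix A assume A: "A \<in> carrier ?M"
    note cl = entry[OF A[unfolded carr]]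
    show "\<one>\<^bsub>?M\<^esub> \<otimes>\<^bsub>?M\<^esub> A = A"
    proof (rule eqI)
      fix i j assume ij: "i \<in> I" "j \<in> I"
      have "(\<one>\<^bsub>?M\<^esub> \<otimes>\<^bsub>?M\<^esub> A) (i, j) = (\<Oplus>k\<in>I. (if i = k then \<one> else \<zero>) \<otimes> A (k, j))"
        using ij cl by (subst mult) (auto intro!: mult_cong simp: one)
      also have "\<dots> = A (i, j)"
        using ij cl by (intro delta_l) auto
      finally show "(\<one>\<^bsub>?M\<^esub> \<otimes>\<^bsub>?M\<^esub> A) (i, j) = A (i, j)" .
    qed (use A mult_closed one_closed in auto)
    show "A \<otimes>\<^bsub>?M\<^esub> \<one>\<^bsub>?M\<^esub> = A"
    proof (rule eqI)
      fix i j assume ij: "i \<in> I" "j \<in> I"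
      have "(A \<otimes>\<^bsub>?M\<^esub> \<one>\<^bsub>?M\<^esub>) (i, j) = (\<Oplus>k\<in>I. A (i, k) \<otimes> (if k = j then \<one> else \<zero>))"
        using ij cl by (subst mult) (auto intro!: mult_cong simp: one)
      also have "\<dots> = A (i, j)"
        using ij cl by (intro delta_r) auto
      finally show "(A \<otimes>\<^bsub>?M\<^esub> \<one>\<^bsub>?M\<^esub>) (i, j) = A (i, j)" .
    qed (use A mult_closed one_closed in auto)
  qed (use mult_closed one_closed in auto)
qed

end

theory Submission
  imports Defs
begin

text \<open>
  Write \<open>A = 1 + N\<close> and regard the entries of \<open>N\<close> as edge weights of a digraph on the index set; a
  walk carries the product of the weights of its edges. The theorem comes from a description of the
  \<open>1\<close>-principled matrices over \<open>\<int>/d\<int>\<close>: all closed walks, loops included, have product \<open>0\<close>. For such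
  an \<open>A\<close>, let \<open>J i j\<close> be the ideal generated by the products of all walks of positive length from
  \<open>i\<close> to \<open>j\<close>. Walks can be concatenated, so \<open>J i j * J j k \<subseteq> J i k\<close>, and \<open>J i i = 0\<close>. Hence the
  matrices \<open>1 + X\<close> with \<open>X i j \<in> J i j\<close> are closed under multiplication, and Gaussian elimination without row exchanges
  inverts them inside that set, so they form a group containing \<open>A\<close>. Each of them is
  \<open>1\<close>-principled: a permutation other than the identity has a nontrivial cycle, and the product of
  the entries along it lies in some \<open>J i i = 0\<close>, so that only the identity contributes to a minor.

  It remains to see that closed walks have product \<open>0\<close>, which uses the arithmetic of \<open>\<int>/d\<int>\<close>.
  Modulo a prime power \<open>p ^ k\<close> dividing \<open>d\<close>, entries have valuations, and \<open>0\<close> can be given the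
  valuation \<open>k\<close>. A shortest closed walk with
  nonzero product is a cycle \<open>C\<close> without repeated vertices. Let \<open>S\<close> be its vertex set and \<open>V < k\<close>
  its total valuation. A chord of \<open>C\<close> closes up with an arc of \<open>C\<close> to a shorter closed
  walk, whose total valuation is at least \<open>k\<close>. If a permutation of \<open>S\<close> uses a chord, adding these
  inequalities over all its edges shows that its product vanishes modulo \<open>p ^ k\<close>
  (\<open>permutation_weight_bound\<close>). The only permutations that use no chord are the identity and
  \<open>C\<close> itself, so the minor on \<open>S\<close> is \<open>1\<close> plus or minus the product along \<open>C\<close>. As that minor is \<open>1\<close>,
  the product along \<open>C\<close> vanishes after all, a contradiction. An integer divisible by all prime powers
  that divide \<open>d\<close> is divisible by \<open>d\<close>, also for \<open>d = 0\<close>.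

  All of this is carried out with integer matrices and divisibility, where the ideal \<open>J i j\<close> is
  generated by a greatest common divisor; the homomorphism \<open>ZMod d\<close> transports the result to
  \<open>ZFact d\<close>.
\<close>

section \<open>Permutations against a Hamiltonian cycle\<close>

definition walk_prod :: "('a \<Rightarrow> 'a \<Rightarrow> int) \<Rightarrow> (nat \<Rightarrow> 'a) \<Rightarrow> nat \<Rightarrow> int" where
  "walk_prod N c l = (\<Prod>t<l. N (c t) (c (Suc t)))"

definition minor :: "('a \<Rightarrow> 'a \<Rightarrow> int) \<Rightarrow> 'a set \<Rightarrow> int" where
  "minor M S = (\<Sum>\<sigma> | \<sigma> permutes S. sign \<sigma> * (\<Prod>x\<in>S. M x (\<sigma> x)))"

definition sub_id :: "('a \<Rightarrow> 'a \<Rightarrow> int) \<Rightarrow> 'a \<Rightarrow> 'a \<Rightarrow> int" where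
  "sub_id M x y = M x y - of_bool (x = y)"

text \<open>
  For a cycle \<open>C\<close> whose vertices have positions \<open>\<rho>\<close>, let \<open>s x\<close> be the weight of the initial part of \<open>C\<close>
  up to \<open>x\<close>, and \<open>V\<close> the weight of \<open>C\<close>. The arc of \<open>C\<close> from \<open>\<sigma> x\<close> to \<open>x\<close> then has weight
  \<open>s x - s (\<sigma> x)\<close>, plus \<open>V\<close> if it passes the starting point, that is if \<open>\<rho> x < \<rho> (\<sigma> x)\<close>. So
  \<open>edge\<close> says that the edge from \<open>x\<close> to \<open>\<sigma> x\<close> and this arc together weigh at least \<open>V\<close>, and \<open>chord\<close>
  that for \<open>x = z\<close> they weigh at least \<open>K\<close>.

  The potential \<open>s\<close> cancels when summed over the permutation, so only \<open>f x = w x + s x - s (\<sigma> x)\<close>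
  counts, and this is never negative. Not every moved point can move forward; one that moves
  backward contributes at least \<open>V\<close>, and \<open>z\<close> at least \<open>K - V\<close>, or \<open>K\<close> if it is the same point.
\<close>
lemma permutation_weight_bound:
  fixes s w :: "'a \<Rightarrow> int" and \<rho> :: "'a \<Rightarrow> nat"
  assumes S: "finite S" "\<sigma> permutes S" and V: "0 \<le> V"
    and nonneg: "\<And>x. x \<in> S \<Longrightarrow> 0 \<le> w x"
    and edge: "\<And>x. x \<in> S \<Longrightarrow> \<sigma> x \<noteq> x \<Longrightarrow>
      V + s (\<sigma> x) - s x \<le> w x + (if \<rho> x < \<rho> (\<sigma> x) then V else 0)"
    and chord: "z \<in> S" "\<sigma> z \<noteq> z"
      "K + s (\<sigma> z) - s z \<le> w z + (if \<rho> z < \<rho> (\<sigma> z) then V else 0)"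
  shows "K \<le> (\<Sum>x\<in>S. w x)"
proof -
  define f where "f x = w x + s x - s (\<sigma> x)" for x
  have sum_perm: "(\<Sum>x\<in>S. h (\<sigma> x)) = (\<Sum>x\<in>S. h x)" for h :: "'a \<Rightarrow> int"
    using sum.permute[OF S(2), of h] by (simp add: o_def)
  have sum_f: "(\<Sum>x\<in>S. w x) = (\<Sum>x\<in>S. f x)"
    using sum_perm[of s] by (simp add: f_def sum.distrib sum_subtractf)
  have f_nonneg: "0 \<le> f x" if "x \<in> S" for x
    using nonneg[OF that] edge[OF that] V by (cases "\<sigma> x = x") (auto simp: f_def split: if_splits)
  obtain y where y: "y \<in> S" "\<sigma> y \<noteq> y" "\<rho> (\<sigma> y) \<le> \<rho> y"
  proof (rule ccontr)
    assume "\<not> thesis"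
    then have inc: "\<rho> x < \<rho> (\<sigma> x)" if "x \<in> S" "\<sigma> x \<noteq> x" for x
      using that \<open>\<And>y. \<lbrakk>y \<in> S; \<sigma> y \<noteq> y; \<rho> (\<sigma> y) \<le> \<rho> y\<rbrakk> \<Longrightarrow> thesis\<close> by (meson not_le)
    have "(\<Sum>x\<in>S. int (\<rho> x)) < (\<Sum>x\<in>S. int (\<rho> (\<sigma> x)))"
    proof (rule sum_strict_mono_ex1)
      show "\<forall>x\<in>S. int (\<rho> x) \<le> int (\<rho> (\<sigma> x))"
        using inc by (metis less_imp_le of_nat_le_iff order_refl)
      show "\<exists>x\<in>S. int (\<rho> x) < int (\<rho> (\<sigma> x))"
        using inc chord by auto
    qed (use S in auto)
    with sum_perm[of "\<lambda>x. int (\<rho> x)"] show False by simp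
  qed
  show ?thesis
  proof (cases "y = z")
    case True
    then have "K \<le> f z"
      using y chord(3) by (simp add: f_def)
    also have "\<dots> \<le> (\<Sum>x\<in>S. f x)"
      using S chord(1) f_nonneg by (intro member_le_sum) auto
    finally show ?thesis
      using sum_f by simp
  next
    case False
    have "V \<le> f y"
      using edge[OF y(1,2)] y(3) by (simp add: f_def)
    moreover have "K - V \<le> f z"
      using chord(3) V by (auto simp: f_def split: if_splits)
    moreover have "f y + f z = (\<Sum>x\<in>{y, z}. f x)"
      using False by simp
    moreover have "(\<Sum>x\<in>{y, z}. f x) \<le> (\<Sum>x\<in>S. f x)"
      using S y(1) chord(1) f_nonneg by (intro sum_mono2) auto
    ultimately show ?thesis
      using sum_f by linarith
  qed
qed

text \<open>
  The finite value at \<open>0\<close>, in place of infinity, suffices because the valuation only serves to decide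
  divisibility by \<open>p ^ k\<close>; \<open>multiplicity p 0\<close> is \<open>0\<close> by convention.
\<close>
definition truncated_val :: "int \<Rightarrow> nat \<Rightarrow> int \<Rightarrow> nat" where
  "truncated_val p k x = (if x = 0 then k else multiplicity p x)"

lemma prime_power_dvd_prod_iff:
  assumes p: "Factorial_Ring.prime p" and "finite F"
  shows "p ^ k dvd (\<Prod>x\<in>F. f x) \<longleftrightarrow> k \<le> (\<Sum>x\<in>F. truncated_val p k (f x))"
proof (cases "0 \<in> f ` F")
  case True
  then obtain x where x: "x \<in> F" "f x = 0" by auto
  have "k = truncated_val p k (f x)" using x by (simp add: truncated_val_def)
  also have "\<dots> \<le> (\<Sum>x\<in>F. truncated_val p k (f x))"
    using assms x by (intro member_le_sum) auto
  finally have "k \<le> (\<Sum>x\<in>F. truncated_val p k (f x))" .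
  moreover have "prod f F = 0"
    using x assms by (intro prod_zero) auto
  ultimately show ?thesis by simp
next
  case False
  then have "multiplicity p (prod f F) = (\<Sum>x\<in>F. multiplicity p (f x))"
    using assms by (intro prime_elem_multiplicity_prod_distrib) auto
  moreover have "(\<Sum>x\<in>F. multiplicity p (f x)) = (\<Sum>x\<in>F. truncated_val p k (f x))"
    using False by (intro sum.cong) (auto simp: truncated_val_def image_iff)
  moreover have "prod f F \<noteq> 0"
    using False assms by (auto simp: prod_zero_iff image_iff)
  ultimately show ?thesis
    using p by (subst power_dvd_iff_le_multiplicity) auto
qed

lemma dvd_prod_minus_one:
  fixes f :: "'a \<Rightarrow> int"
  assumes "finite F" "\<And>x. x \<in> F \<Longrightarrow> q dvd f x - 1"
  shows "q dvd (\<Prod>x\<in>F. f x) - 1"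
  using assms
proof (induction F)
  case (insert x F)
  have "prod f (insert x F) - 1 = (f x - 1) * prod f F + (prod f F - 1)"
    using insert by (simp add: algebra_simps)
  also have "q dvd \<dots>"
    using insert by (intro dvd_add dvd_mult2) auto
  finally show ?case .
qed auto

text \<open>
  Suppose that the product along the cycle \<open>c\<close> is nonzero modulo \<open>p ^ k\<close>. By \<open>permutation_weight_bound\<close>, a
  permutation of \<open>S\<close> that uses a chord of \<open>c\<close> then contributes \<open>0\<close> to the minor. The only others are the identity, which contributes \<open>1\<close>, and the
  cycle itself.
\<close>
lemma prime_power_dvd_simple_cycle:
  fixes M :: "'a \<Rightarrow> 'a \<Rightarrow> int"
  defines "N \<equiv> sub_id M"
  assumes p: "Factorial_Ring.prime p" and l: "0 < l" and cl: "c l = c 0"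
    and inj: "inj_on c {..<l}" and S: "S = c ` {..<l}"
    and minor: "p ^ k dvd minor M S - 1"
    and shorter: "\<And>m e. 0 < m \<Longrightarrow> m < l \<Longrightarrow> e m = e 0 \<Longrightarrow> e ` {..<m} \<subseteq> S \<Longrightarrow>
      p ^ k dvd walk_prod N e m"
  shows "p ^ k dvd walk_prod N c l"
proof (cases "l = 1")
  case True
  then have "S = {c 0}" using S by auto
  then have "minor M S = M (c 0) (c 0)"
    by (simp add: minor_def sign_id)
  with minor True cl show ?thesis
    by (simp add: walk_prod_def N_def sub_id_def)
next
  case False
  with l have l2: "2 \<le> l" by simp
  have finS: "finite S" using S by simp
  show ?thesis
  proof (rule ccontr)
    assume nd: "\<not> p ^ k dvd walk_prod N c l"
    \<comment> \<open>The position on the cycle, the cycle continued periodically, and its partial weights.\<close>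
    define r where "r = inv_into {..<l} c"
    have r: "r x < l" "c (r x) = x" if "x \<in> S" for x
      using that inv_into_into[of x c "{..<l}"] f_inv_into_f[of x c "{..<l}"] S by (auto simp: r_def)
    have rc: "r (c i) = i" if "i < l" for i
      using that inj by (simp add: r_def)
    have inS: "c i \<in> S" if "i \<le> l" for i
      using that S cl l by (cases "i = l") auto
    define cx where "cx i = c (i mod l)" for i
    have cx: "cx i = c i" if "i \<le> l" for i
      using that cl by (cases "i = l") (auto simp: cx_def)
    have cxS: "cx i \<in> S" for i
      using inS[of "i mod l"] l by (simp add: cx_def less_imp_le)
    have cx_add: "cx (l + i) = cx i" for i
      by (simp add: cx_def)
    define u where "u i = truncated_val p k (N (cx i) (cx (Suc i)))" for i
    have u_add: "u (l + i) = u i" for i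
      using cx_add[of i] cx_add[of "Suc i"] by (simp add: u_def)
    define sn where "sn i = (\<Sum>t<i. u t)" for i
    define V where "V = sn l"
    have "V < k"
    proof -
      have "walk_prod N c l = (\<Prod>t<l. N (cx t) (cx (Suc t)))"
        unfolding walk_prod_def by (intro prod.cong) (auto simp: cx)
      with nd show ?thesis
        using prime_power_dvd_prod_iff[OF p, of "{..<l}" k "\<lambda>t. N (cx t) (cx (Suc t))"]
        by (simp add: V_def sn_def u_def)
    qed
    have sn_add: "sn (l + a) = V + sn a" for a
      by (induction a) (auto simp: sn_def V_def u_add)
    have diag: "p ^ k dvd N x x" if "x \<in> S" for x
      using shorter[of 1 "\<lambda>_. x"] l2 that by (auto simp: walk_prod_def)
    \<comment> \<open>An edge from \<open>cx a\<close> back to \<open>cx b\<close> closes the arc from \<open>b\<close> to \<open>a\<close>. The indices refer to the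
      periodic continuation, so that the arc may pass the starting point.\<close>
    have shortcut: "k + sn b \<le> sn a + truncated_val p k (N (cx a) (cx b))"
      if "b \<le> a" "Suc (a - b) < l" for a b
    proof -
      define e where "e t = (if t \<le> a - b then cx (b + t) else cx b)" for t
      have "p ^ k dvd walk_prod N e (Suc (a - b))"
        using that cxS by (intro shorter) (auto simp: e_def)
      then have "k \<le> (\<Sum>t<Suc (a - b). truncated_val p k (N (e t) (e (Suc t))))"
        unfolding walk_prod_def by (rule prime_power_dvd_prod_iff[OF p finite_lessThan, THEN iffD1])
      also have "\<dots> = (\<Sum>t<a - b. u (b + t)) + truncated_val p k (N (cx a) (cx b))"
        using that by (auto simp: e_def u_def intro!: sum.cong)
      finally have "k \<le> (\<Sum>t<a - b. u (b + t)) + truncated_val p k (N (cx a) (cx b))" .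
      moreover have "sn (b + m) = sn b + (\<Sum>t<m. u (b + t))" for m
        by (induction m) (auto simp: sn_def)
      from this[of "a - b"] have "sn a = sn b + (\<Sum>t<a - b. u (b + t))"
        using that by simp
      ultimately show ?thesis by simp
    qed
    have chord: "int k + int (sn (r y)) - int (sn (r x))
        \<le> int (truncated_val p k (N x y)) + (if r x < r y then int V else 0)"
      if xy: "x \<in> S" "y \<in> S" "y \<noteq> c (Suc (r x))" for x y
    proof (cases "r x < r y")
      case True
      have "r y \<noteq> Suc (r x)" using xy r by metis
      with True r[OF xy(1)] r[OF xy(2)] have "Suc ((l + r x) - r y) < l" by linarith
      from shortcut[OF _ this] show ?thesis
        using True r[OF xy(1)] r[OF xy(2)] by (simp add: sn_add cx_add cx)
    next
      case False
      have "\<not> (r y = 0 \<and> Suc (r x) = l)" using xy r cl by metis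
      with False r[OF xy(1)] r[OF xy(2)] have "Suc (r x - r y) < l" by linarith
      from shortcut[OF _ this] show ?thesis
        using False r[OF xy(1)] r[OF xy(2)] by (simp add: cx)
    qed
    have arc: "int V + int (sn (r y)) - int (sn (r x))
        \<le> int (truncated_val p k (N x y)) + (if r x < r y then int V else 0)"
      if xy: "x \<in> S" "y = c (Suc (r x))" for x y
    proof (cases "Suc (r x) = l")
      case True
      then have "r y = 0" using xy cl rc[of 0] l by simp
      moreover have "V = sn (r x) + u (r x)" using True unfolding V_def sn_def by (metis sum.lessThan_Suc)
      moreover have "u (r x) = truncated_val p k (N x y)"
        using True xy r[OF xy(1)] by (simp add: u_def cx)
      ultimately show ?thesis by (simp add: sn_def)
    next
      case False
      then have "Suc (r x) < l" using r[OF xy(1)] by simp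
      then have "r y = Suc (r x)" using xy rc by simp
      moreover have "u (r x) = truncated_val p k (N x y)"
        using xy r[OF xy(1)] by (simp add: u_def cx)
      ultimately show ?thesis by (simp add: sn_def)
    qed
    \<comment> \<open>The cycle as a permutation of its vertex set.\<close>
    define \<tau> where "\<tau> x = (if x \<in> S then c (Suc (r x)) else x)" for x
    have tau_c: "\<tau> (c i) = c (Suc i)" if "i < l" for i
      using that inS rc by (simp add: \<tau>_def)
    have tau_cx: "\<tau> (cx i) = cx (Suc i)" for i
      using tau_c[of "i mod l"] l cl by (simp add: cx_def mod_Suc)
    have tau_ne: "\<tau> x \<noteq> x" if "x \<in> S" for x
    proof -
      have "r (\<tau> x) \<noteq> r x"
        using r[OF that] rc[of "Suc (r x)"] rc[of 0] l2 cl that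
        by (cases "Suc (r x) = l") (auto simp: \<tau>_def)
      then show ?thesis by auto
    qed
    have tau: "\<tau> permutes S"
    proof (rule bij_imp_permutes)
      have "\<tau> ` S = S"
      proof
        show "\<tau> ` S \<subseteq> S" using r inS by (auto simp: \<tau>_def Suc_le_eq)
        show "S \<subseteq> \<tau> ` S"
        proof
          fix y assume y: "y \<in> S"
          then have "y = \<tau> (cx (r y + l - 1))"
            using tau_cx[of "r y + l - 1"] l cx_add[of "r y"] r[OF y] cx[of "r y"]
            by (simp add: add.commute)
          with cxS show "y \<in> \<tau> ` S" by blast
        qed
      qed
      then show "bij_betw \<tau> S S"
        using finS by (simp add: bij_betw_def finite_surj_inj)
    qed (simp add: \<tau>_def)
    have other: "p ^ k dvd (\<Prod>x\<in>S. M x (\<sigma> x))"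
      if sig: "\<sigma> permutes S" "\<sigma> \<noteq> id" "\<sigma> \<noteq> \<tau>" for \<sigma>
    proof -
      have "\<exists>z\<in>S. \<sigma> z \<noteq> z \<and> \<sigma> z \<noteq> \<tau> z"
      proof (rule ccontr)
        assume "\<not> ?thesis"
        then have alt: "\<sigma> z = z \<or> \<sigma> z = \<tau> z" if "z \<in> S" for z using that by blast
        from sig obtain x where x: "\<sigma> x \<noteq> x" by (metis eq_id_iff)
        then have xS: "x \<in> S" using sig by (meson permutes_not_in)
        \<comment> \<open>One step along the cycle forces the next, since the point just reached cannot be fixed by
          the injective \<open>\<sigma>\<close>.\<close>
        have run: "\<sigma> (cx (r x + t)) = \<tau> (cx (r x + t))" for t
        proof (induction t)
          case 0
          then show ?case using alt[OF xS] x r[OF xS] by (simp add: cx)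
        next
          case (Suc t)
          let ?y = "cx (r x + t)"
          have "\<sigma> (\<tau> ?y) \<noteq> \<tau> ?y"
            using Suc tau_ne[OF cxS] permutes_inj[OF sig(1)] by (metis injD)
          then show ?case using alt[OF cxS, of "r x + Suc t"] tau_cx by simp
        qed
        have "\<sigma> y = \<tau> y" for y
        proof (cases "y \<in> S")
          case True
          then have "y = cx (r x + (l + r y - r x))"
            using r[OF True] r[OF xS] by (simp add: cx_add cx)
          then show ?thesis using run by metis
        next
          case False
          then show ?thesis using sig by (simp add: \<tau>_def permutes_not_in)
        qed
        with sig show False by auto
      qed
      then obtain z where z: "z \<in> S" "\<sigma> z \<noteq> z" "\<sigma> z \<noteq> \<tau> z" by blast
      have sS: "\<sigma> x \<in> S" if "x \<in> S" for x
        using that permutes_in_image[OF sig(1)] by simp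
      have MN: "M x (\<sigma> x) = N x (\<sigma> x)" if "\<sigma> x \<noteq> x" for x
        using that by (simp add: N_def sub_id_def)
      have "int k \<le> (\<Sum>x\<in>S. int (truncated_val p k (M x (\<sigma> x))))"
      proof (rule permutation_weight_bound[OF finS sig(1), of "int V" _ "\<lambda>x. int (sn (r x))" r z])
        fix x assume x: "x \<in> S" "\<sigma> x \<noteq> x"
        show "int V + int (sn (r (\<sigma> x))) - int (sn (r x))
          \<le> int (truncated_val p k (M x (\<sigma> x))) + (if r x < r (\<sigma> x) then int V else 0)"
          using arc[OF x(1), of "\<sigma> x"] chord[OF x(1) sS[OF x(1)]] MN[OF x(2)] \<open>V < k\<close> by force
      next
        show "int k + int (sn (r (\<sigma> z))) - int (sn (r z))
          \<le> int (truncated_val p k (M z (\<sigma> z))) + (if r z < r (\<sigma> z) then int V else 0)"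
          using chord[OF z(1) sS[OF z(1)]] MN[OF z(2)] z by (simp add: \<tau>_def)
      qed (use z in auto)
      then have "k \<le> (\<Sum>x\<in>S. truncated_val p k (M x (\<sigma> x)))"
        by (metis of_nat_le_iff of_nat_sum)
      then show ?thesis
        by (rule prime_power_dvd_prod_iff[OF p finS, THEN iffD2])
    qed
    define f where "f \<sigma> = sign \<sigma> * (\<Prod>x\<in>S. M x (\<sigma> x))" for \<sigma> :: "'a \<Rightarrow> 'a"
    have "id \<noteq> \<tau>"
      using tau_ne[OF inS[of 0]] by auto
    then have "minor M S = f id + f \<tau> + (\<Sum>\<sigma>\<in>{\<sigma>. \<sigma> permutes S} - {id, \<tau>}. f \<sigma>)"
      unfolding minor_def f_def[symmetric] using tau finS
      by (subst sum.subset_diff[of "{id, \<tau>}"]) (auto simp: finite_permutations permutes_id)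
    moreover have "p ^ k dvd (\<Sum>\<sigma>\<in>{\<sigma>. \<sigma> permutes S} - {id, \<tau>}. f \<sigma>)"
      using other by (intro dvd_sum) (auto simp: f_def)
    moreover have "p ^ k dvd f id - 1"
      using diag dvd_prod_minus_one[OF finS, of "p ^ k" "\<lambda>x. M x x"]
      by (simp add: f_def sign_id N_def sub_id_def)
    ultimately have "p ^ k dvd f \<tau>"
      using minor by (smt (verit, ccfv_SIG) dvd_add_left_iff dvd_add_right_iff)
    moreover have "(\<Prod>x\<in>S. M x (\<tau> x)) = walk_prod N c l"
    proof -
      have "(\<Prod>x\<in>S. M x (\<tau> x)) = (\<Prod>x\<in>S. N x (\<tau> x))"
        using tau_ne by (intro prod.cong) (auto simp: N_def sub_id_def dest: not_sym)
      also have "\<dots> = walk_prod N c l"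
        unfolding S walk_prod_def prod.reindex[OF inj] o_def
        by (intro prod.cong) (auto simp: tau_c)
      finally show ?thesis .
    qed
    ultimately have "p ^ k dvd walk_prod N c l"
      by (cases \<tau> rule: sign_cases) (auto simp: f_def)
    with nd show False ..
  qed
qed

section \<open>Closed walks of a matrix with principal minors 1\<close>

text \<open>
  A closed walk that visits a vertex twice contains a shorter closed walk, whose product divides its
  product; otherwise it is a simple cycle.
\<close>
lemma prime_power_dvd_closed_walk:
  fixes M :: "'a \<Rightarrow> 'a \<Rightarrow> int"
  assumes p: "Factorial_Ring.prime p"
    and minor: "\<And>S. finite S \<Longrightarrow> S \<subseteq> I \<Longrightarrow> p ^ k dvd minor M S - 1"
  shows "0 < l \<Longrightarrow> c l = c 0 \<Longrightarrow> c ` {..<l} \<subseteq> I \<Longrightarrow> p ^ k dvd walk_prod (sub_id M) c l"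
proof (induction l arbitrary: c rule: less_induct)
  case (less l)
  show ?case
  proof (cases "inj_on c {..<l}")
    case True
    show ?thesis
      by (rule prime_power_dvd_simple_cycle[OF p less.prems(1,2) True refl])
        (use less minor in \<open>auto intro!: minor less.IH\<close>)
  next
    case False
    then obtain i j where ij: "i < j" "j < l" "c i = c j"
      unfolding inj_on_def by (metis lessThan_iff nat_neq_iff)
    have "p ^ k dvd walk_prod (sub_id M) (\<lambda>t. c (i + t)) (j - i)"
      using ij less.prems(3) by (intro less.IH) auto
    also have "\<dots> = (\<Prod>t\<in>(+) i ` {..<j - i}. sub_id M (c t) (c (Suc t)))"
      by (subst prod.reindex) (auto simp: walk_prod_def)
    also have "\<dots> dvd walk_prod (sub_id M) c l"
      unfolding walk_prod_def using ij by (intro prod_dvd_prod_subset) auto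
    finally show ?thesis .
  qed
qed

lemma dvd_if_prime_powers_dvd:
  fixes d x :: int
  assumes "\<And>p k. Factorial_Ring.prime p \<Longrightarrow> p ^ k dvd d \<Longrightarrow> p ^ k dvd x"
  shows "d dvd x"
proof (cases "d = 0 \<or> x = 0")
  case False
  show ?thesis
  proof (rule multiplicity_le_imp_dvd)
    fix p :: int assume p: "Factorial_Ring.prime p"
    have "p ^ multiplicity p d dvd x"
      using p by (intro assms multiplicity_dvd)
    then show "multiplicity p d \<le> multiplicity p x"
      using False p by (intro multiplicity_geI) auto
  qed (use False in simp)
next
  case True
  have "x = 0" if "d = 0"
  proof (rule ccontr)
    assume "x \<noteq> 0"
    then have "\<not> 2 ^ Suc (multiplicity 2 x) dvd x"
      by (subst power_dvd_iff_le_multiplicity) auto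
    moreover have "Factorial_Ring.prime (2::int)" by simp
    ultimately show False using assms[of 2 "Suc (multiplicity 2 x)"] that by auto
  qed
  with True show ?thesis by auto
qed

section \<open>The ideals of walk products\<close>

text \<open>
  The generator of the ideal spanned by the products of the walks of positive length from \<open>i\<close> to \<open>j\<close>
  within \<open>I\<close>. The default \<open>Gcd {} = 0\<close> is the right value when there is no such walk.
\<close>
definition walk_gcd :: "('a \<Rightarrow> 'a \<Rightarrow> int) \<Rightarrow> 'a set \<Rightarrow> 'a \<Rightarrow> 'a \<Rightarrow> int" where
  "walk_gcd N I i j =
    Gcd {walk_prod N c l |c l. 0 < l \<and> c 0 = i \<and> c l = j \<and> c ` {..l} \<subseteq> I}"

lemma dvd_Gcd_mult_Gcd:
  fixes q :: int
  assumes "\<And>x y. x \<in> X \<Longrightarrow> y \<in> Y \<Longrightarrow> q dvd x * y"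
  shows "q dvd Gcd X * Gcd Y"
proof -
  have "q dvd Gcd Y * x" if "x \<in> X" for x
  proof -
    have "q dvd Gcd ((*) x ` Y)"
      using assms that by (auto intro: Gcd_greatest)
    then show ?thesis by (simp only: Gcd_mult dvd_normalize_iff mult.commute)
  qed
  then have "q dvd Gcd ((*) (Gcd Y) ` X)"
    by (auto intro: Gcd_greatest)
  then show ?thesis by (simp only: Gcd_mult dvd_normalize_iff mult.commute)
qed

lemma walk_prod_append:
  assumes "c l = c' 0"
  shows "walk_prod N (\<lambda>t. if t \<le> l then c t else c' (t - l)) (l + l') =
    walk_prod N c l * walk_prod N c' l'"
proof (induction l')
  case 0
  show ?case by (simp add: walk_prod_def)
next
  case (Suc l')
  then show ?case
    using assms by (auto simp: walk_prod_def)
qed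

lemma walk_gcd_triangle: "walk_gcd N I i k dvd walk_gcd N I i j * walk_gcd N I j k"
  unfolding walk_gcd_def[of _ _ i j] walk_gcd_def[of _ _ j k]
proof (rule dvd_Gcd_mult_Gcd)
  let ?W = "\<lambda>i j. {walk_prod N c l |c l. 0 < l \<and> c 0 = i \<and> c l = j \<and> c ` {..l} \<subseteq> I}"
  fix x y assume xy: "x \<in> ?W i j" "y \<in> ?W j k"
  then obtain c l c' l' where
    c: "x = walk_prod N c l" "0 < l" "c 0 = i" "c l = j" "c ` {..l} \<subseteq> I" and
    c': "y = walk_prod N c' l'" "0 < l'" "c' 0 = j" "c' l' = k" "c' ` {..l'} \<subseteq> I"
    by blast
  define e where "e t = (if t \<le> l then c t else c' (t - l))" for t
  have "walk_prod N e (l + l') = x * y"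
    using walk_prod_append[of c l c' N l'] c c' by (simp add: e_def[abs_def])
  moreover have "e 0 = i" "e (l + l') = k" "e ` {..l + l'} \<subseteq> I"
    using c c' by (auto simp: e_def image_subset_iff)
  ultimately have "x * y \<in> ?W i k"
    using c(2) by (metis (mono_tags, lifting) add_gr_0 mem_Collect_eq)
  then show "walk_gcd N I i k dvd x * y"
    unfolding walk_gcd_def by (rule Gcd_dvd)
qed

lemma walk_gcd_dvd_entry:
  assumes "i \<in> I" "j \<in> I"
  shows "walk_gcd N I i j dvd N i j"
proof -
  define c where "c t = (if t = 0 then i else j)" for t :: nat
  have "N i j = walk_prod N c 1" "c 0 = i" "c 1 = j" "c ` {..1} \<subseteq> I"
    using assms by (auto simp: walk_prod_def c_def)
  then have "N i j \<in> {walk_prod N c l |c l. 0 < l \<and> c 0 = i \<and> c l = j \<and> c ` {..l} \<subseteq> I}"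
    by (metis (mono_tags, lifting) mem_Collect_eq zero_less_one)
  then show ?thesis
    unfolding walk_gcd_def by (rule Gcd_dvd)
qed

definition mat_prod :: "'a set \<Rightarrow> ('a \<Rightarrow> 'a \<Rightarrow> int) \<Rightarrow> ('a \<Rightarrow> 'a \<Rightarrow> int) \<Rightarrow> 'a \<Rightarrow> 'a \<Rightarrow> int" where
  "mat_prod I M B i j = (\<Sum>k\<in>I. M i k * B k j)"

lemma sub_id_mat_prod:
  assumes "finite I" "i \<in> I" "j \<in> I"
  shows "sub_id (mat_prod I M B) i j =
    mat_prod I (sub_id M) (sub_id B) i j + sub_id M i j + sub_id B i j"
proof -
  have "mat_prod I M B i j = (\<Sum>k\<in>I. sub_id M i k * sub_id B k j
      + (if k = j then sub_id M i k else 0) + (if i = k then B k j else 0))"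
    unfolding mat_prod_def by (intro sum.cong) (auto simp: sub_id_def algebra_simps)
  also have "\<dots> = mat_prod I (sub_id M) (sub_id B) i j + sub_id M i j + B i j"
    using assms by (simp add: sum.distrib mat_prod_def)
  finally show ?thesis by (simp add: sub_id_def)
qed

lemma permutation_cycle:
  assumes "finite S" "\<sigma> permutes S"
  obtains n where "0 < n" "(\<sigma> ^^ n) x = x" "inj_on (\<lambda>t. (\<sigma> ^^ t) x) {..<n}"
proof -
  have cancel: "(\<sigma> ^^ (j - i)) x = x" if "i < j" "(\<sigma> ^^ i) x = (\<sigma> ^^ j) x" for i j
  proof -
    have "(\<sigma> ^^ i) ((\<sigma> ^^ (j - i)) x) = (\<sigma> ^^ i) x"
      using that by (metis add_diff_inverse_nat comp_apply funpow_add less_imp_le not_le)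
    then show ?thesis
      using inj_fn[OF permutes_inj[OF assms(2)]] by (metis injD)
  qed
  have "finite (range (\<lambda>t. (\<sigma> ^^ t) x))"
  proof (rule finite_subset)
    show "range (\<lambda>t. (\<sigma> ^^ t) x) \<subseteq> insert x S"
    proof clarify
      fix t assume "(\<sigma> ^^ t) x \<notin> S"
      then show "(\<sigma> ^^ t) x = x"
        using assms(2) by (induction t) (auto simp: permutes_in_image permutes_not_in)
    qed
  qed (use assms in simp)
  then have "\<not> inj (\<lambda>t. (\<sigma> ^^ t) x)"
    using finite_imageD infinite_UNIV_nat by blast
  then obtain i j where "i < j" "(\<sigma> ^^ i) x = (\<sigma> ^^ j) x"
    unfolding inj_on_def by (metis nat_neq_iff)
  then have ex: "0 < j - i \<and> (\<sigma> ^^ (j - i)) x = x"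
    using cancel by simp
  define n where "n = (LEAST n. 0 < n \<and> (\<sigma> ^^ n) x = x)"
  have n: "0 < n" "(\<sigma> ^^ n) x = x"
    using LeastI[of "\<lambda>n. 0 < n \<and> (\<sigma> ^^ n) x = x", OF ex] by (auto simp: n_def)
  have "\<not> (i < j \<and> j < n \<and> (\<sigma> ^^ i) x = (\<sigma> ^^ j) x)" for i j
    using not_less_Least[of "j - i" "\<lambda>n. 0 < n \<and> (\<sigma> ^^ n) x = x"] cancel[of i j]
    unfolding n_def[symmetric] by (metis less_imp_diff_less zero_less_diff)
  then have "inj_on (\<lambda>t. (\<sigma> ^^ t) x) {..<n}"
    unfolding inj_on_def by (metis lessThan_iff nat_neq_iff)
  with n show thesis by (rule that)
qed

section \<open>The group of matrices dominated by a multiplicative weight\<close>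

text \<open>
  Only the two properties of \<open>walk_gcd\<close> that make the following a group of \<open>1\<close>-principled matrices
  modulo \<open>d\<close> are retained. By \<open>triangle\<close>, the matrices \<open>X\<close> with \<open>g i j dvd X i j\<close> are closed under
  multiplication; by \<open>closed_dvd\<close>, their products along closed walks vanish modulo \<open>d\<close>.
\<close>
locale multiplicative_weight =
  fixes I :: "'a set" and g :: "'a \<Rightarrow> 'a \<Rightarrow> int" and d :: int
  assumes finite_index: "finite I"
    and triangle: "i \<in> I \<Longrightarrow> j \<in> I \<Longrightarrow> k \<in> I \<Longrightarrow> g i k dvd g i j * g j k"
    and closed_dvd: "i \<in> I \<Longrightarrow> d dvd g i i"
begin

definition weight_unipotent :: "('a \<Rightarrow> 'a \<Rightarrow> int) \<Rightarrow> bool" where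
  "weight_unipotent M \<longleftrightarrow> (\<forall>i\<in>I. \<forall>j\<in>I. g i j dvd sub_id M i j)"

lemma weight_unipotent_id: "weight_unipotent (\<lambda>i j. of_bool (i = j))"
  by (simp add: weight_unipotent_def sub_id_def)

lemma weight_unipotent_mat_prod:
  assumes "weight_unipotent M" "weight_unipotent B"
  shows "weight_unipotent (mat_prod I M B)"
  unfolding weight_unipotent_def
proof (intro ballI)
  fix i j assume ij: "i \<in> I" "j \<in> I"
  have "g i j dvd mat_prod I (sub_id M) (sub_id B) i j"
    unfolding mat_prod_def
  proof (rule dvd_sum)
    fix k assume k: "k \<in> I"
    have "g i k * g k j dvd sub_id M i k * sub_id B k j"
      using assms ij k by (intro mult_dvd_mono) (auto simp: weight_unipotent_def)
    then show "g i j dvd sub_id M i k * sub_id B k j"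
      using triangle[OF ij(1) k ij(2)] by (rule dvd_trans[rotated])
  qed
  then show "g i j dvd sub_id (mat_prod I M B) i j"
    using assms ij by (auto simp: sub_id_mat_prod[OF finite_index ij] weight_unipotent_def)
qed

lemma weight_dvd_walk_prod:
  assumes "weight_unipotent M" "0 < l" "c ` {..l} \<subseteq> I"
  shows "g (c 0) (c l) dvd walk_prod (sub_id M) c l"
  using assms(2,3)
proof (induction l rule: nat_induct_non_zero)
  case 1
  have "c 0 \<in> I" "c 1 \<in> I"
    using 1 by auto
  with assms(1) show ?case
    by (simp add: walk_prod_def weight_unipotent_def)
next
  case (Suc l)
  have mem: "c 0 \<in> I" "c l \<in> I" "c (Suc l) \<in> I"
    using Suc.prems by auto
  have "g (c 0) (c l) dvd walk_prod (sub_id M) c l"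
    using Suc by (auto simp: atMost_Suc)
  moreover have "g (c l) (c (Suc l)) dvd sub_id M (c l) (c (Suc l))"
    using assms(1) mem by (simp add: weight_unipotent_def)
  ultimately have "g (c 0) (c l) * g (c l) (c (Suc l)) dvd walk_prod (sub_id M) c (Suc l)"
    by (simp add: walk_prod_def mult_dvd_mono)
  then show ?case
    using triangle[OF mem] by (rule dvd_trans[rotated])
qed

text \<open>
  A permutation that moves some \<open>x\<close> contributes a multiple of the product along the cycle through \<open>x\<close>.
  This cycle is a closed walk, so the product is divisible by \<open>g x x\<close> and thus by \<open>d\<close>.
\<close>
lemma weight_unipotent_minor:
  assumes M: "weight_unipotent M" and S: "S \<subseteq> I"
  shows "d dvd minor M S - 1"
proof -
  have finS: "finite S" using S finite_index by (rule finite_subset)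
  define f where "f \<sigma> = sign \<sigma> * (\<Prod>x\<in>S. M x (\<sigma> x))" for \<sigma> :: "'a \<Rightarrow> 'a"
  have "d dvd f \<sigma>" if sig: "\<sigma> permutes S" "\<sigma> \<noteq> id" for \<sigma>
  proof -
    from sig obtain x where x: "\<sigma> x \<noteq> x" by (metis eq_id_iff)
    then have xS: "x \<in> S" using sig by (meson permutes_not_in)
    define c where "c t = (\<sigma> ^^ t) x" for t
    obtain n where n: "0 < n" "c n = x" "inj_on c {..<n}"
      using permutation_cycle[OF finS sig(1), of x] unfolding c_def by blast
    have cS: "c t \<in> S" for t
      by (induction t) (auto simp: c_def xS permutes_in_image[OF sig(1)])
    have c_Suc: "\<sigma> (c t) = c (Suc t)" for t
      by (simp add: c_def)
    have moved: "\<sigma> (c t) \<noteq> c t" for t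
      using permutes_inj[OF sig(1)] x by (induction t) (auto simp: c_def inj_eq)
    have "d dvd g (c 0) (c n)"
      using closed_dvd xS S n by (auto simp: c_def)
    also have "\<dots> dvd walk_prod (sub_id M) c n"
      using M n cS S by (intro weight_dvd_walk_prod) auto
    also have "\<dots> = (\<Prod>t<n. M (c t) (\<sigma> (c t)))"
      unfolding walk_prod_def using moved
      by (intro prod.cong) (auto simp: sub_id_def c_Suc[symmetric] dest: not_sym)
    also have "\<dots> = (\<Prod>x\<in>c ` {..<n}. M x (\<sigma> x))"
      by (simp add: prod.reindex[OF n(3)])
    also have "\<dots> dvd (\<Prod>x\<in>S. M x (\<sigma> x))"
      using finS cS by (intro prod_dvd_prod_subset) auto
    finally show ?thesis by (simp add: f_def)
  qed
  then have "d dvd (\<Sum>\<sigma>\<in>{\<sigma>. \<sigma> permutes S} - {id}. f \<sigma>)"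
    by (intro dvd_sum) auto
  moreover have "d dvd f id - 1"
  proof -
    have "d dvd M x x - 1" if "x \<in> S" for x
    proof -
      have "x \<in> I" using that S by auto
      then have "d dvd g x x" "g x x dvd sub_id M x x"
        using M closed_dvd by (auto simp: weight_unipotent_def)
      then show ?thesis by (auto simp: sub_id_def)
    qed
    from dvd_prod_minus_one[OF finS this] show ?thesis
      by (simp add: f_def)
  qed
  moreover have "minor M S = f id + (\<Sum>\<sigma>\<in>{\<sigma>. \<sigma> permutes S} - {id}. f \<sigma>)"
    unfolding minor_def f_def[symmetric]
    using finS by (subst sum.remove[of _ id]) (auto simp: finite_permutations permutes_id)
  ultimately show ?thesis
    by (metis (no_types, lifting) add.commute diff_add_eq dvd_add)
qed

text \<open>
  One step of Gaussian elimination. The pivot \<open>M v v\<close> is \<open>1\<close> modulo \<open>d\<close>, so no division is needed, and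
  the columns in \<open>T\<close>, already those of the identity, have \<open>0\<close> in row \<open>v\<close> and stay so. Iterated over
  all columns, it yields a left inverse.
\<close>
lemma weight_unipotent_elimination:
  assumes M: "weight_unipotent M" and v: "v \<in> I"
    and T: "T \<subseteq> I" "\<And>i j. i \<in> I \<Longrightarrow> j \<in> T \<Longrightarrow> d dvd sub_id M i j"
  obtains E where "weight_unipotent E"
    "\<And>i j. i \<in> I \<Longrightarrow> j \<in> insert v T \<Longrightarrow> d dvd sub_id (mat_prod I E M) i j"
proof
  define E where "E i j = of_bool (i = j) - (if j = v then sub_id M i v else 0)" for i j
  show "weight_unipotent E"
    using M by (auto simp: weight_unipotent_def E_def sub_id_def)
  fix i j assume i: "i \<in> I" and j: "j \<in> insert v T"
  have "mat_prod I E M i j =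
      (\<Sum>k\<in>I. (if i = k then M k j else 0) - (if k = v then sub_id M i v * M k j else 0))"
    unfolding mat_prod_def by (intro sum.cong) (auto simp: E_def algebra_simps)
  also have "\<dots> = M i j - sub_id M i v * M v j"
    using i v finite_index by (simp add: sum_subtractf)
  finally have prod: "sub_id (mat_prod I E M) i j = sub_id M i j - sub_id M i v * M v j"
    by (simp add: sub_id_def)
  show "d dvd sub_id (mat_prod I E M) i j"
  proof (cases "j = v")
    case True
    have "d dvd g v v" "g v v dvd sub_id M v v"
      using M closed_dvd v by (auto simp: weight_unipotent_def)
    then have "d dvd sub_id M v v" by (rule dvd_trans)
    moreover have "sub_id (mat_prod I E M) i j = - (sub_id M i v * sub_id M v v)"
      using prod True by (simp add: sub_id_def[of M v v] algebra_simps)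
    ultimately show ?thesis by simp
  next
    case False
    then have "M v j = sub_id M v j" by (simp add: sub_id_def)
    then show ?thesis
      using False i j v T(2) by (auto simp: prod)
  qed
qed

end

section \<open>Reduction of integer matrices modulo d\<close>

lemma ZMod_ring_hom: "ZMod d \<in> ring_hom \<Z> (ZFact d)"
proof -
  have "ZMod d = a_r_coset \<Z> (Idl\<^bsub>\<Z>\<^esub> {d})"
    by (simp add: ZMod_def fun_eq_iff)
  then show ?thesis
    using ideal.rcos_ring_hom[OF int.genideal_ideal[of "{d}"]] by (simp add: ZFact_def)
qed

lemma ZMod_simps:
  shows ZMod_closed: "ZMod d x \<in> carrier (ZFact d)"
    and ZMod_add: "ZMod d (x + y) = ZMod d x \<oplus>\<^bsub>ZFact d\<^esub> ZMod d y"
    and ZMod_mult: "ZMod d (x * y) = ZMod d x \<otimes>\<^bsub>ZFact d\<^esub> ZMod d y"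
    and ZMod_one: "ZMod d 1 = \<one>\<^bsub>ZFact d\<^esub>"
    and ZMod_zero: "ZMod d 0 = \<zero>\<^bsub>ZFact d\<^esub>"
    and ZMod_uminus: "ZMod d (- x) = \<ominus>\<^bsub>ZFact d\<^esub> ZMod d x"
proof -
  interpret R: cring "ZFact d" by (rule ZFact_is_cring)
  show closed: "ZMod d x \<in> carrier (ZFact d)" for x
    using ring_hom_closed[OF ZMod_ring_hom, of x] by simp
  show add: "ZMod d (x + y) = ZMod d x \<oplus>\<^bsub>ZFact d\<^esub> ZMod d y" for x y
    using ring_hom_add[OF ZMod_ring_hom, of x y] by simp
  show "ZMod d (x * y) = ZMod d x \<otimes>\<^bsub>ZFact d\<^esub> ZMod d y"
    using ring_hom_mult[OF ZMod_ring_hom, of x y] by simp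
  show "ZMod d 1 = \<one>\<^bsub>ZFact d\<^esub>"
    using ring_hom_one[OF ZMod_ring_hom] by simp
  show zero: "ZMod d 0 = \<zero>\<^bsub>ZFact d\<^esub>"
    using add[of 0 0] closed[of 0] R.add.l_cancel_one by force
  show "ZMod d (- x) = \<ominus>\<^bsub>ZFact d\<^esub> ZMod d x"
    using add[of "- x" x] zero closed by (intro R.minus_equality[symmetric]) auto
qed

lemma ZMod_eq_iff: "ZMod d x = ZMod d y \<longleftrightarrow> d dvd x - y"
  by (simp add: ZMod_eq_mod mod_eq_dvd_iff)

lemma ZMod_surj:
  assumes "X \<in> carrier (ZFact d)"
  obtains x where "X = ZMod d x"
  using assms unfolding ZFact_def FactRing_def ZMod_def A_RCOSETS_def' by auto

lemma ZMod_sum: "ZMod d (\<Sum>x\<in>F. f x) = (\<Oplus>\<^bsub>ZFact d\<^esub>x\<in>F. ZMod d (f x))"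
proof -
  interpret R: cring "ZFact d" by (rule ZFact_is_cring)
  show ?thesis
    by (induction F rule: infinite_finite_induct) (auto simp: ZMod_simps)
qed

lemma ZMod_prod: "ZMod d (\<Prod>x\<in>F. f x) = (\<Otimes>\<^bsub>ZFact d\<^esub>x\<in>F. ZMod d (f x))"
proof -
  interpret R: cring "ZFact d" by (rule ZFact_is_cring)
  show ?thesis
    by (induction F rule: infinite_finite_induct) (auto simp: ZMod_simps)
qed

definition mat_image :: "int \<Rightarrow> 'a set \<Rightarrow> ('a \<Rightarrow> 'a \<Rightarrow> int) \<Rightarrow> 'a \<times> 'a \<Rightarrow> int set" where
  "mat_image d I M = (\<lambda>(i, j)\<in>I \<times> I. ZMod d (M i j))"

lemma mat_image_closed: "mat_image d I M \<in> carrier (mat_monoid (ZFact d) I)"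
  by (auto simp: mat_image_def mat_monoid_def ZMod_closed)

lemma mat_image_surj:
  assumes "A \<in> carrier (mat_monoid (ZFact d) I)"
  obtains M where "A = mat_image d I M"
proof -
  have A: "A \<in> (I \<times> I) \<rightarrow>\<^sub>E carrier (ZFact d)"
    using assms by (simp add: mat_monoid_def)
  have "\<exists>x. A (i, j) = ZMod d x" if "i \<in> I" "j \<in> I" for i j
    using A that by (auto elim!: PiE_E intro: ZMod_surj)
  then obtain M where M: "\<And>i j. i \<in> I \<Longrightarrow> j \<in> I \<Longrightarrow> A (i, j) = ZMod d (M i j)" by metis
  have "A = mat_image d I M"
    unfolding mat_image_def
    using A M by (intro extensionalityI[OF _ restrict_extensional]) (auto simp: PiE_iff)
  then show thesis by (rule that)
qed

lemma mat_image_eqI: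
  assumes "\<And>i j. i \<in> I \<Longrightarrow> j \<in> I \<Longrightarrow> d dvd M i j - B i j"
  shows "mat_image d I M = mat_image d I B"
  unfolding mat_image_def by (rule restrict_ext) (clarsimp simp: ZMod_eq_iff assms)

lemma mat_image_mat_prod:
  "mat_image d I (mat_prod I M B) =
    mat_image d I M \<otimes>\<^bsub>mat_monoid (ZFact d) I\<^esub> mat_image d I B"
proof -
  interpret R: cring "ZFact d" by (rule ZFact_is_cring)
  have "ZMod d (mat_prod I M B i j) =
      (\<Oplus>\<^bsub>ZFact d\<^esub>k\<in>I. mat_image d I M (i, k) \<otimes>\<^bsub>ZFact d\<^esub> mat_image d I B (k, j))"
    if "i \<in> I" "j \<in> I" for i j
    unfolding mat_prod_def ZMod_sum
    using that by (intro R.finsum_cong') (simp_all add: mat_image_def ZMod_mult ZMod_closed)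
  then show ?thesis
    unfolding mat_image_def[of d I "mat_prod I M B"] mat_monoid_def monoid.simps
    by (intro restrict_ext) clarsimp
qed

lemma mat_image_id: "mat_image d I (\<lambda>i j. of_bool (i = j)) = \<one>\<^bsub>mat_monoid (ZFact d) I\<^esub>"
  by (intro ext) (auto simp: mat_image_def mat_monoid_def ZMod_one ZMod_zero)

lemma mat_det_mat_image:
  assumes "S \<subseteq> I"
  shows "mat_det (ZFact d) S (principal_submat (mat_image d I M) S) = ZMod d (minor M S)"
proof -
  interpret R: cring "ZFact d" by (rule ZFact_is_cring)
  have "[sign \<sigma>] \<cdot>\<^bsub>ZFact d\<^esub> (\<Otimes>\<^bsub>ZFact d\<^esub>i\<in>S. principal_submat (mat_image d I M) S (i, \<sigma> i)) =
      ZMod d (sign \<sigma> * (\<Prod>x\<in>S. M x (\<sigma> x)))" if "\<sigma> permutes S" for \<sigma>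
  proof -
    have "(\<Otimes>\<^bsub>ZFact d\<^esub>i\<in>S. principal_submat (mat_image d I M) S (i, \<sigma> i)) =
        (\<Otimes>\<^bsub>ZFact d\<^esub>i\<in>S. ZMod d (M i (\<sigma> i)))"
      using assms permutes_in_image[OF that]
      by (intro R.finprod_cong') (auto simp: principal_submat_def mat_image_def ZMod_closed subset_iff)
    also have "\<dots> = ZMod d (\<Prod>x\<in>S. M x (\<sigma> x))"
      by (simp add: ZMod_prod)
    finally show ?thesis
      by (cases \<sigma> rule: sign_cases)
        (simp_all add: R.add.int_pow_1 R.add.int_pow_neg ZMod_closed ZMod_uminus)
  qed
  then show ?thesis
    unfolding mat_det_def minor_def ZMod_sum
    by (intro R.finsum_cong') (auto simp: ZMod_closed)
qed

lemma one_principled_mat_image: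
  "one_principled (ZFact d) I (mat_image d I M) \<longleftrightarrow> (\<forall>S\<subseteq>I. d dvd minor M S - 1)"
  by (simp add: one_principled_def mat_image_closed mat_det_mat_image ZMod_eq_iff
      flip: ZMod_one)

section \<open>Integer powers\<close>

text \<open>
  If \<open>y\<close> is a left inverse of \<open>x\<close> and \<open>z\<close> one of \<open>y\<close>, then \<open>z = z y x = x\<close>, so left inverses within \<open>H\<close>
  are two-sided and agree with the inverses of the ambient monoid.
\<close>
lemma (in monoid) int_pow_mem_left_invertible_submonoid:
  assumes H: "H \<subseteq> carrier G" "\<one> \<in> H" "\<And>x y. x \<in> H \<Longrightarrow> y \<in> H \<Longrightarrow> x \<otimes> y \<in> H"
    and left_inverse: "\<And>x. x \<in> H \<Longrightarrow> \<exists>y\<in>H. y \<otimes> x = \<one>"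
    and a: "a \<in> H"
  shows "a [^] (m :: int) \<in> H"
proof -
  have pow: "a [^] (k :: nat) \<in> H" for k
    by (induction k) (auto simp: H a)
  have inv_mem: "inv x \<in> H" if x: "x \<in> H" for x
  proof -
    obtain y where y: "y \<in> H" "y \<otimes> x = \<one>" using left_inverse[OF x] by blast
    obtain z where z: "z \<in> H" "z \<otimes> y = \<one>" using left_inverse[OF y(1)] by blast
    have car: "x \<in> carrier G" "y \<in> carrier G" "z \<in> carrier G"
      using x y z H(1) by auto
    have "z = z \<otimes> (y \<otimes> x)" using y car by simp
    also have "\<dots> = x" using z car by (simp add: m_assoc[symmetric])
    finally have "inv x = y"
      using y z car by (intro inv_unique'[symmetric]) auto
    with y show ?thesis by simp
  qed
  show ?thesis
    unfolding int_pow_def2 by (simp only: pow inv_mem split: if_split) simp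
qed

theorem one_principled_int_pow:
  assumes I: "finite I" and A: "one_principled (ZFact d) I A"
  shows "one_principled (ZFact d) I (A [^]\<^bsub>mat_monoid (ZFact d) I\<^esub> (m :: int))"
proof -
  interpret R: cring "ZFact d" by (rule ZFact_is_cring)
  let ?G = "mat_monoid (ZFact d) I"
  interpret G: Group.monoid ?G
    by (rule R.monoid_mat_monoid[OF I])
  obtain M where M: "A = mat_image d I M"
    using A by (auto simp: one_principled_def elim: mat_image_surj)
  have minors: "d dvd minor M S - 1" if "S \<subseteq> I" for S
    using A that by (simp add: M one_principled_mat_image)
  have closed: "d dvd walk_prod (sub_id M) c l" if "0 < l" "c l = c 0" "c ` {..l} \<subseteq> I" for c l
  proof (rule dvd_if_prime_powers_dvd)
    fix p :: int and k assume "Factorial_Ring.prime p" "p ^ k dvd d"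
    then show "p ^ k dvd walk_prod (sub_id M) c l"
      using minors that by (intro prime_power_dvd_closed_walk[of p I]) (auto intro: dvd_trans)
  qed
  define g where "g = walk_gcd (sub_id M) I"
  interpret multiplicative_weight I g d
  proof
    show "d dvd g i i" for i
      unfolding g_def walk_gcd_def by (rule Gcd_greatest) (auto intro: closed)
  qed (simp_all add: I g_def walk_gcd_triangle)
  define H where "H = mat_image d I ` Collect weight_unipotent"
  have mult: "X \<otimes>\<^bsub>?G\<^esub> Y \<in> H" if "X \<in> H" "Y \<in> H" for X Y
    using that weight_unipotent_mat_prod by (auto simp: H_def simp flip: mat_image_mat_prod)
  have one: "\<one>\<^bsub>?G\<^esub> \<in> H"
    using weight_unipotent_id by (auto simp: H_def simp flip: mat_image_id)
  have H_carrier: "H \<subseteq> carrier ?G"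
    by (auto simp: H_def mat_image_closed)
  have left_inverse: "\<exists>Y\<in>H. Y \<otimes>\<^bsub>?G\<^esub> X = \<one>\<^bsub>?G\<^esub>" if X: "X \<in> H" for X
  proof -
    have "\<exists>Y\<in>H. \<exists>B. weight_unipotent B \<and> Y \<otimes>\<^bsub>?G\<^esub> X = mat_image d I B \<and>
        (\<forall>i\<in>I. \<forall>j\<in>T. d dvd sub_id B i j)" if "finite T" "T \<subseteq> I" for T
      using that
    proof (induction T)
      case empty
      have "\<one>\<^bsub>?G\<^esub> \<otimes>\<^bsub>?G\<^esub> X = X" using X H_carrier by auto
      moreover obtain B where "weight_unipotent B" "X = mat_image d I B"
        using X by (auto simp: H_def)
      ultimately show ?case using one by blast
    next
      case (insert v T)
      then have sub: "v \<in> I" "T \<subseteq> I" by auto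
      from insert.IH[OF this(2)] obtain Y B where Y: "Y \<in> H" and B: "weight_unipotent B"
        "Y \<otimes>\<^bsub>?G\<^esub> X = mat_image d I B" "\<forall>i\<in>I. \<forall>j\<in>T. d dvd sub_id B i j"
        by blast
      obtain E where E: "weight_unipotent E"
        "\<And>i j. i \<in> I \<Longrightarrow> j \<in> insert v T \<Longrightarrow> d dvd sub_id (mat_prod I E B) i j"
        using weight_unipotent_elimination[OF B(1) sub B(3)[rule_format]] by blast
      let ?E = "mat_image d I E"
      have EH: "?E \<in> H" using E by (auto simp: H_def)
      have "(?E \<otimes>\<^bsub>?G\<^esub> Y) \<otimes>\<^bsub>?G\<^esub> X = mat_image d I (mat_prod I E B)"
        using EH X Y H_carrier B(2) by (simp add: G.m_assoc mat_image_mat_prod subset_iff)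
      then show ?case
        using mult[OF EH Y] weight_unipotent_mat_prod[OF E(1) B(1)] E(2) by blast
    qed
    from this[OF I order_refl] obtain Y B where Y: "Y \<in> H" "Y \<otimes>\<^bsub>?G\<^esub> X = mat_image d I B"
      "\<forall>i\<in>I. \<forall>j\<in>I. d dvd sub_id B i j" by blast
    have "mat_image d I B = \<one>\<^bsub>?G\<^esub>"
      unfolding mat_image_id[symmetric] using Y(3) by (intro mat_image_eqI) (simp add: sub_id_def)
    with Y show ?thesis by auto
  qed
  have "weight_unipotent M"
    unfolding weight_unipotent_def unfolding g_def by (simp add: walk_gcd_dvd_entry)
  then have A_H: "A \<in> H" unfolding M H_def by blast
  have "A [^]\<^bsub>?G\<^esub> m \<in> H"
  proof (rule G.int_pow_mem_left_invertible_submonoid)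
    show "H \<subseteq> carrier ?G" by (rule H_carrier)
    show "\<one>\<^bsub>?G\<^esub> \<in> H" by (rule one)
    show "X \<otimes>\<^bsub>?G\<^esub> Y \<in> H" if "X \<in> H" "Y \<in> H" for X Y
      using that by (rule mult)
    show "\<exists>Y\<in>H. Y \<otimes>\<^bsub>?G\<^esub> X = \<one>\<^bsub>?G\<^esub>" if "X \<in> H" for X
      using that by (rule left_inverse)
    show "A \<in> H" by (rule A_H)
  qed
  then obtain B where "A [^]\<^bsub>?G\<^esub> m = mat_image d I B" "weight_unipotent B"
    unfolding H_def by blast
  moreover from this have "\<forall>S\<subseteq>I. d dvd minor B S - 1"
    by (blast intro: weight_unipotent_minor)
  ultimately show ?thesis
    by (simp only: one_principled_mat_image)
qed

theorem corollary5p4: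
  fixes d :: int and n :: nat and A :: "nat \<times> nat \<Rightarrow> int set"
  assumes "one_principled (ZFact d) {1..n} A"
  shows "\<forall>m::int. one_principled (ZFact d) {1..n} (A [^]\<^bsub>mat_monoid (ZFact d) {1..n}\<^esub> m)"
  using one_principled_int_pow[OF _ assms] by simp

end
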